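(* Let $n_1,n_2>0$, $\alpha\in(0,1)$, $z=z_{\alpha/2}>0$, and for $(p_1,p_2)\in(0,1)^2$ let $\mathrm{Error}(p_1,p_2)$ be the coverage error of the EO interval (defined in the context) under $\hat p\sim N(p,V)$. Then: (a) (Range.) $0\le\mathrm{Error}(p_1,p_2)<\alpha$ for every $(p_1,p_2)\in(0,1)^2$, and the upper bound is approached but not attained: $\mathrm{Error}(p_1,p_2)\to\alpha$ as $(p_1,p_2)\to(0,0)$ or $(p_1,p_2)\to(1,1)$. (b) (Zero-error locus.) If $|p_1-p_2|\le\hat p_\square$, then $\mathrm{Error}(p_1,p_2)=0$ if and only if $\delta(p_1,p_2):=n_2(p_1-\tfrac12)+n_1(p_2-\tfrac12)=0$, that is, if and only if $$\beta_1p_1+\beta_2p_2=1,\qquad\beta_1=\frac{2n_2}{n_1+n_2},\quad\beta_2=\frac{2n_1}{n_1+n_2},$$ a line of slope $-n_2/n_1$ through $(\tfrac12,\tfrac12)$, with $\beta_1+\beta_2=2$; when $n_1=n_2$ this is the line $p_1+p_2=1$. For $|p_1-p_2|>\hat p_\square$ the error vanishes only on the boundary of the unit square, and is therefore strictly positive at every such $(p_1,p_2)\in(0,1)^2$. (c) (Symmetry.) $\mathrm{Error}(1-p_1,1-p_2)=\mathrm{Error}(p_1,p_2)$. The error is likewise invariant under the simultaneous interchange of $(p_1,p_2)$ with $(p_2,p_1)$ and of $n_1$ with $n_2$. (d) (Scale invariance.) If $n_1=c_1N$ and $n_2=c_2N$ with $c_1,c_2>0$ fixed, then $\mathcal R(p_1,p_2)$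 does not depend on $N$. Consequently the coverage error does not tend to zero as the sample sizes grow: for fixed $(p_1,p_2)\in(0,1)^2$ off the line $\beta_1p_1+\beta_2p_2=1$ of (b), it converges as $N\to\infty$ to the strictly positive constant $2[\Phi(z\mathcal R(p_1,p_2))-\Phi(z)]$. If $n_1=n_2=n$ and $p_1=p_2=q$, then $\mathcal R^2=[4q(1-q)]^{-1}$ for every $n$.
   Context: $\Phi$ is the standard normal distribution function and $z=z_{\alpha/2}$ means $\Phi(z)=1-\alpha/2$. Put $\hat p_\square=\dfrac{\max(n_1,n_2)+\min(n_1,n_2)}{2\max(n_1,n_2)}$, $p=p_1-p_2$, $V(q_1,q_2)=\frac{q_1(1-q_1)}{n_1}+\frac{q_2(1-q_2)}{n_2}$, $V=V(p_1,p_2)$, $V^*(p)=\max\{V(q_1,q_2):(q_1,q_2)\in[0,1]^2,\ q_1-q_2=p\}$, and $\mathcal R(p_1,p_2)=\sqrt{V^*(p)/V(p_1,p_2)}$. For real $\hat p$ let $$\Omega_\square(\hat p)=\{(q_1,q_2)\in[0,1]^2:(\hat p-q_1+q_2)^2\le z^2V(q_1,q_2)\},$$ $$\Gamma(\hat p)=\Bigl\{(q_1,q_2)\in[0,1]^2:\min_{(r_1,r_2)\in\Omega_\square(\hat p)}(r_1-r_2)\le q_1-q_2\le\max_{(r_1,r_2)\in\Omega_\square(\hat p)}(r_1-r_2)\Bigr\},$$ with $\Gamma(\hat p)=\emptyset$ if $\Omega_\square(\hat p)=\emptyset$. With $\hat p\sim N(p,V)$, $$\mathrm{Error}(p_1,p_2)=\mathbb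 P\bigl((p_1,p_2)\in\Gamma(\hat p)\bigr)-\mathbb P\bigl((p_1,p_2)\in\Omega_\square(\hat p)\bigr).$$ (The event $(p_1,p_2)\in\Gamma(\hat p)$ is the event that the elliptically optimal (EO) interval $[\min_{\Omega_\square(\hat p)}(r_1-r_2),\max_{\Omega_\square(\hat p)}(r_1-r_2)]$ covers $p$.) *)

theory Defs
  imports "HOL-Probability.Probability"
begin

definition Phi :: "real \<Rightarrow> real" where
  "Phi = cdf std_normal_distribution"

definition Vfun :: "real \<Rightarrow> real \<Rightarrow> real \<Rightarrow> real \<Rightarrow> real" where
  "Vfun n1 n2 q1 q2 = q1 * (1 - q1) / n1 + q2 * (1 - q2) / n2"

text \<open>The suprema and infima below are attained whenever \<open>\<bar>p\<bar> \<le> 1\<close> (for \<open>Vstar\<close>) and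
  \<open>Omega\<close> is nonempty (for the interval bounds): see \<open>Vstar_attained\<close> and
  \<open>eo_bounds_attained\<close>.\<close>

definition Vstar :: "real \<Rightarrow> real \<Rightarrow> real \<Rightarrow> real" where
  "Vstar n1 n2 p =
     Sup {Vfun n1 n2 q1 q2 |q1 q2. q1 \<in> {0..1} \<and> q2 \<in> {0..1} \<and> q1 - q2 = p}"

definition Rratio :: "real \<Rightarrow> real \<Rightarrow> real \<Rightarrow> real \<Rightarrow> real" where
  "Rratio n1 n2 p1 p2 = sqrt (Vstar n1 n2 (p1 - p2) / Vfun n1 n2 p1 p2)"

definition phat_sq :: "real \<Rightarrow> real \<Rightarrow> real" where
  "phat_sq n1 n2 = (max n1 n2 + min n1 n2) / (2 * max n1 n2)"

definition Omega :: "real \<Rightarrow> real \<Rightarrow> real \<Rightarrow> real \<Rightarrow> (real \<times> real) set" where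
  "Omega n1 n2 z x =
     {(q1, q2). q1 \<in> {0..1} \<and> q2 \<in> {0..1} \<and> (x - q1 + q2)\<^sup>2 \<le> z\<^sup>2 * Vfun n1 n2 q1 q2}"

definition eo_lower :: "real \<Rightarrow> real \<Rightarrow> real \<Rightarrow> real \<Rightarrow> real" where
  "eo_lower n1 n2 z x = (INF (r1, r2) \<in> Omega n1 n2 z x. r1 - r2)"

definition eo_upper :: "real \<Rightarrow> real \<Rightarrow> real \<Rightarrow> real \<Rightarrow> real" where
  "eo_upper n1 n2 z x = (SUP (r1, r2) \<in> Omega n1 n2 z x. r1 - r2)"

definition Gamma_set :: "real \<Rightarrow> real \<Rightarrow> real \<Rightarrow> real \<Rightarrow> (real \<times> real) set" where
  "Gamma_set n1 n2 z x =
     (if Omega n1 n2 z x = {} then {}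
      else {(q1, q2). q1 \<in> {0..1} \<and> q2 \<in> {0..1} \<and>
                      eo_lower n1 n2 z x \<le> q1 - q2 \<and> q1 - q2 \<le> eo_upper n1 n2 z x})"

text \<open>The normal law with mean \<open>m\<close> and \<^emph>\<open>variance\<close> \<open>v\<close>. The degenerate law \<open>v = 0\<close> only occurs
  at the corners of the unit square.\<close>

definition normal_law :: "real \<Rightarrow> real \<Rightarrow> real measure" where
  "normal_law m v =
     (if v = 0 then return borel m else density lborel (normal_density m (sqrt v)))"

text \<open>Both events below are closed intervals of real numbers, hence measurable. For \<open>Gamma_set\<close>:
  \<open>Omega\<close> is compact and convex, so the event says that \<open>r1 - r2 = p1 - p2\<close> for some
  \<open>(r1, r2)\<close> in \<open>Omega\<close>, i.e. \<open>(x - (p1 - p2))\<^sup>2 \<le> z\<^sup>2 * Vstar n1 n2 (p1 - p2)\<close>.\<close>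

definition Error :: "real \<Rightarrow> real \<Rightarrow> real \<Rightarrow> real \<Rightarrow> real \<Rightarrow> real" where
  "Error n1 n2 z p1 p2 =
     measure (normal_law (p1 - p2) (Vfun n1 n2 p1 p2)) {x. (p1, p2) \<in> Gamma_set n1 n2 z x}
   - measure (normal_law (p1 - p2) (Vfun n1 n2 p1 p2)) {x. (p1, p2) \<in> Omega n1 n2 z x}"

definition delta :: "real \<Rightarrow> real \<Rightarrow> real \<Rightarrow> real \<Rightarrow> real" where
  "delta n1 n2 p1 p2 = n2 * (p1 - 1/2) + n1 * (p2 - 1/2)"

definition beta1 :: "real \<Rightarrow> real \<Rightarrow> real" where
  "beta1 n1 n2 = 2 * n2 / (n1 + n2)"

definition beta2 :: "real \<Rightarrow> real \<Rightarrow> real" where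
  "beta2 n1 n2 = 2 * n1 / (n1 + n2)"

lemma Vstar_attained:
  assumes "\<bar>p\<bar> \<le> 1"
  shows "\<exists>q1\<in>{0..1}. \<exists>q2\<in>{0..1}. q1 - q2 = p \<and> Vfun n1 n2 q1 q2 = Vstar n1 n2 p \<and>
    (\<forall>r1\<in>{0..1}. \<forall>r2\<in>{0..1}. r1 - r2 = p \<longrightarrow> Vfun n1 n2 r1 r2 \<le> Vstar n1 n2 p)"
proof -
  let ?S = "({0..1} \<times> {0..1}) \<inter> {x::real \<times> real. fst x - snd x = p}"
  let ?f = "\<lambda>x. Vfun n1 n2 (fst x) (snd x)"
  have "compact ?S"
    by (intro compact_Int_closed compact_Times closed_Collect_eq continuous_intros) auto
  moreover have "(max p 0, max p 0 - p) \<in> ?S"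
    using assms by (auto simp: max_def)
  then have "?S \<noteq> {}" by blast
  moreover have "continuous_on ?S ?f"
    unfolding Vfun_def divide_inverse by (intro continuous_intros)
  ultimately obtain s where s: "s \<in> ?S" and m: "\<forall>y\<in>?S. ?f y \<le> ?f s"
    using continuous_attains_sup[of ?S ?f] by blast
  have eq: "?f s = Vstar n1 n2 p"
    unfolding Vstar_def
    by (rule cSup_eq_maximum[symmetric]) (use s m in force)+
  have "Vfun n1 n2 r1 r2 \<le> Vstar n1 n2 p"
    if "r1 \<in> {0..1}" "r2 \<in> {0..1}" "r1 - r2 = p" for r1 r2
    using bspec[OF m, of "(r1, r2)"] that eq by auto
  moreover have "fst s \<in> {0..1}" "snd s \<in> {0..1}" "fst s - snd s = p"
    using s by auto
  ultimately show ?thesis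
    using eq by blast
qed

lemma eo_bounds_attained:
  assumes "Omega n1 n2 z x \<noteq> {}"
  shows "\<exists>(r1, r2)\<in>Omega n1 n2 z x. r1 - r2 = eo_lower n1 n2 z x"
    and "\<exists>(r1, r2)\<in>Omega n1 n2 z x. r1 - r2 = eo_upper n1 n2 z x"
    and "\<forall>(r1, r2)\<in>Omega n1 n2 z x. eo_lower n1 n2 z x \<le> r1 - r2 \<and> r1 - r2 \<le> eo_upper n1 n2 z x"
proof -
  let ?S = "Omega n1 n2 z x"
  let ?f = "\<lambda>(r1, r2). r1 - r2 :: real"
  have S: "?S = ({0..1} \<times> {0..1}) \<inter>
      {q. (x - fst q + snd q)\<^sup>2 \<le> z\<^sup>2 * Vfun n1 n2 (fst q) (snd q)}"
    by (auto simp: Omega_def)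
  have c: "compact ?S"
    unfolding S Vfun_def divide_inverse
    by (intro compact_Int_closed compact_Times closed_Collect_le continuous_intros) auto
  have f: "continuous_on ?S ?f"
    by (auto simp: case_prod_beta intro!: continuous_intros)
  obtain s where s: "s \<in> ?S" "\<forall>y\<in>?S. ?f y \<le> ?f s"
    using continuous_attains_sup[OF c assms f] by blast
  obtain t where t: "t \<in> ?S" "\<forall>y\<in>?S. ?f t \<le> ?f y"
    using continuous_attains_inf[OF c assms f] by blast
  have u: "eo_upper n1 n2 z x = ?f s"
    unfolding eo_upper_def by (rule cSup_eq_maximum) (use s in auto)
  have l: "eo_lower n1 n2 z x = ?f t"
    unfolding eo_lower_def by (rule cInf_eq_minimum) (use t in auto)
  show "\<exists>(r1, r2)\<in>?S. r1 - r2 = eo_lower n1 n2 z x"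
    unfolding l using t(1) by (intro bexI[of _ t]) auto
  show "\<exists>(r1, r2)\<in>?S. r1 - r2 = eo_upper n1 n2 z x"
    unfolding u using s(1) by (intro bexI[of _ s]) auto
  show "\<forall>(r1, r2)\<in>?S. eo_lower n1 n2 z x \<le> r1 - r2 \<and> r1 - r2 \<le> eo_upper n1 n2 z x"
    unfolding u l using s(2) t(2) by auto
qed

end

theory Submission
  imports Defs
begin

text \<open>
  Everything follows from one formula: on the open unit square
  \<open>Error = 2 * (Phi (z * R) - Phi z)\<close> with \<open>R\<close> the ratio \<open>sqrt (V\<^sup>* / V)\<close>.

  The formula comes from rewriting both events as events about the centred variable \<open>x - p\<close>.
  Membership of \<open>(p1, p2)\<close> in \<open>Omega\<close> is by definition \<open>(x - p)\<^sup>2 \<le> z\<^sup>2 V\<close>. For \<open>Gamma_set\<close>, the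
  variance \<open>V\<close> is concave, so \<open>Omega\<close> is convex and its image under \<open>r1 - r2\<close> is an interval
  without gaps; lying between the two extremes thus means being a value of \<open>r1 - r2\<close> on \<open>Omega\<close>,
  and the best chance for the value \<open>p\<close> is a maximiser of \<open>V\<close> on the segment \<open>r1 - r2 = p\<close>. So
  the event is \<open>(x - p)\<^sup>2 \<le> z\<^sup>2 V\<^sup>*\<close> (\<open>Gamma_set_iff\<close>). Standardising the normal law
  gives the formula (\<open>Error_eq_Phi\<close>).

  Since \<open>Phi\<close> is strictly increasing with limit 1 and \<open>2 * (1 - Phi z) = \<alpha>\<close>, the range is
  \<open>[0, \<alpha>)\<close>, and the error tends to \<open>\<alpha>\<close> exactly where \<open>R\<close> tends to infinity; this happens at
  the corners on the diagonal because there \<open>V\<close> vanishes while \<open>V\<^sup>*\<close> does not. The error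
  vanishes iff \<open>R = 1\<close>, that is, iff the point maximises \<open>V\<close> on its own segment. Along
  that segment \<open>V\<close> is a strictly concave parabola whose slope at the point is a multiple of
  \<open>delta\<close> (\<open>Vfun_shift\<close>), so an interior point is the maximiser iff \<open>delta = 0\<close>. The
  number \<open>phat_sq\<close> is the largest \<open>\<bar>p1 - p2\<bar>\<close> on the line \<open>delta = 0\<close> within the closed square, so
  beyond it the error is positive. Symmetry and scale invariance are those of \<open>R\<close>.
\<close>

section \<open>The standard normal distribution function\<close>

interpretation std_normal: real_distribution std_normal_distribution
  by (rule real_dist_normal_dist)

lemma std_normal_singleton: "measure std_normal_distribution {x} = 0"
proof -
  have "{x} \<in> null_sets std_normal_distribution"
    by (rule absolutely_continuousI_density[unfolded absolutely_continuous_def, THEN subsetD]) auto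
  then show ?thesis
    by (simp add: measure_def null_setsD1)
qed

lemma isCont_Phi: "isCont Phi x"
  unfolding Phi_def by (simp add: std_normal.isCont_cdf std_normal_singleton)

text \<open>The density is positive everywhere, so a null interval for the normal law would be a null
  interval for Lebesgue measure.\<close>

lemma Phi_strict_mono: "strict_mono Phi"
proof (rule strict_monoI)
  fix x y :: real
  assume xy: "x < y"
  have "{x<..y} \<notin> null_sets std_normal_distribution"
  proof
    assume "{x<..y} \<in> null_sets std_normal_distribution"
    then have "AE t in lborel. t \<in> {x<..y} \<longrightarrow> ennreal (std_normal_density t) = 0"
      by (subst (asm) null_sets_density_iff) auto
    then have "AE t in lborel. t \<notin> {x<..y}"
    proof eventually_elim
      case (elim t)
      then show ?case
        using normal_density_pos[of 1 0 t] by (auto simp: ennreal_eq_0_iff)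
    qed
    then have "emeasure lborel {x<..y} = 0"
      by (subst (asm) AE_iff_measurable[of "{x<..y}"]) auto
    with xy show False by simp
  qed
  then have "measure std_normal_distribution {x<..y} \<noteq> 0"
    by (simp add: null_sets_def std_normal.emeasure_eq_measure)
  then show "Phi x < Phi y"
    using std_normal.cdf_diff_eq[OF xy] measure_nonneg[of std_normal_distribution "{x<..y}"]
    unfolding Phi_def by linarith
qed

lemma Phi_less_one: "Phi x < 1"
  using strict_monoD[OF Phi_strict_mono, of x "x + 1"] std_normal.cdf_bounded_prob[of "x + 1"]
  unfolding Phi_def by simp

lemma Phi_tendsto_one: "(Phi \<longlongrightarrow> 1) at_top"
  unfolding Phi_def by (rule std_normal.cdf_lim_at_top_prob)

lemma distr_std_normal_affine:
  assumes "a \<noteq> 0"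
  shows "distr std_normal_distribution borel (\<lambda>x. m + a * x) = density lborel (normal_density m \<bar>a\<bar>)"
proof -
  have "distributed std_normal_distribution lborel (\<lambda>x. x) std_normal_density"
    unfolding distributed_def
    by (auto intro!: measure_eqI simp: emeasure_distr)
  from std_normal.normal_density_affine[OF this, of a m]
  have "distr std_normal_distribution lborel (\<lambda>x. m + a * x) = density lborel (normal_density m \<bar>a\<bar>)"
    using assms by (simp add: distributed_def)
  then show ?thesis
    by (simp cong: distr_cong)
qed

lemma Phi_minus: "Phi (- x) = 1 - Phi x"
proof -
  have "distr std_normal_distribution borel uminus = std_normal_distribution"
    using distr_std_normal_affine[of "-1" 0] by (simp cong: distr_cong)
  then have "measure std_normal_distribution {..- x}
      = measure (distr std_normal_distribution borel uminus) {..- x}"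
    by simp
  also have "\<dots> = measure std_normal_distribution {x..}"
    by (subst measure_distr) (auto intro!: arg_cong[where f = "measure _"])
  also have "\<dots> = measure std_normal_distribution ({x} \<union> {x<..})"
    by (intro arg_cong[where f = "measure _"]) auto
  also have "\<dots> = measure std_normal_distribution {x<..}"
    by (subst std_normal.finite_measure_Union) (auto simp: std_normal_singleton)
  also have "{x<..} = space std_normal_distribution - {..x}"
    by auto
  also have "measure std_normal_distribution \<dots> = 1 - measure std_normal_distribution {..x}"
    by (rule std_normal.prob_compl) auto
  finally show ?thesis
    by (simp add: Phi_def cdf_def)
qed

text \<open>Standardisation: the substitution \<open>x = m + sqrt v * y\<close> turns the event into
  \<open>\<bar>y\<bar> \<le> z * sqrt (w / v)\<close>.\<close>

lemma normal_law_central: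
  assumes v: "v > 0" and w: "w \<ge> 0" and z: "z > 0"
  shows "measure (normal_law m v) {x. (x - m)\<^sup>2 \<le> z\<^sup>2 * w} = 2 * Phi (z * sqrt (w / v)) - 1"
proof -
  define c where "c = z * sqrt (w / v)"
  have c: "c \<ge> 0" using v w z by (simp add: c_def)
  have c2: "v * c\<^sup>2 = z\<^sup>2 * w"
    using v w by (simp add: c_def power_mult_distrib)
  have law: "normal_law m v = distr std_normal_distribution borel (\<lambda>x. m + sqrt v * x)"
    using v by (subst distr_std_normal_affine) (auto simp: normal_law_def)
  have event: "(sqrt v * x)\<^sup>2 \<le> z\<^sup>2 * w \<longleftrightarrow> x \<in> {-c..c}" for x
  proof -
    have "(sqrt v * x)\<^sup>2 \<le> z\<^sup>2 * w \<longleftrightarrow> v * x\<^sup>2 \<le> v * c\<^sup>2"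
      unfolding c2 using v by (simp add: power_mult_distrib)
    also have "\<dots> \<longleftrightarrow> x\<^sup>2 \<le> c\<^sup>2"
      using v by (rule mult_le_cancel_left_pos)
    also have "\<dots> \<longleftrightarrow> \<bar>x\<bar> \<le> c"
      using abs_le_square_iff[of x c] abs_of_nonneg[OF c] by metis
    also have "\<dots> \<longleftrightarrow> x \<in> {-c..c}"
      unfolding atLeastAtMost_iff by linarith
    finally show ?thesis .
  qed
  have "measure (normal_law m v) {x. (x - m)\<^sup>2 \<le> z\<^sup>2 * w}
      = measure std_normal_distribution {-c..c}"
    unfolding law
    by (subst measure_distr) (simp_all add: event del: atLeastAtMost_iff)
  also have "{-c..c} = {-c} \<union> {-c<..c}"
    using c by auto
  also have "measure std_normal_distribution \<dots> = measure std_normal_distribution {-c<..c}"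
    by (subst std_normal.finite_measure_Union) (auto simp: std_normal_singleton)
  also have "\<dots> = Phi c - Phi (- c)"
    using std_normal.cdf_diff_eq[of "-c" c] c by (cases "c = 0") (auto simp: Phi_def)
  finally show ?thesis
    by (simp add: Phi_minus c_def)
qed

section \<open>The variance and its maximum on a segment of constant difference\<close>

lemma Vfun_pos:
  assumes "n1 > 0" "n2 > 0" "p1 \<in> {0<..<1}" "p2 \<in> {0<..<1}"
  shows "Vfun n1 n2 p1 p2 > 0"
  using assms by (auto simp: Vfun_def intro!: add_pos_pos divide_pos_pos mult_pos_pos)

lemma Vfun_le_Vstar:
  assumes "q1 \<in> {0..1}" "q2 \<in> {0..1}"
  shows "Vfun n1 n2 q1 q2 \<le> Vstar n1 n2 (q1 - q2)"
  using Vstar_attained[of "q1 - q2" n1 n2] assms by (auto simp: abs_le_iff)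

text \<open>Taylor expansion of the quadratic \<open>Vfun\<close> along the direction \<open>(1, 1)\<close>, which preserves the
  difference of the coordinates.\<close>

lemma Vfun_shift:
  assumes "n1 > 0" "n2 > 0"
  shows "Vfun n1 n2 (q1 + t) (q2 + t)
    = Vfun n1 n2 q1 q2 - t * (2 * delta n1 n2 q1 q2 + t * (n1 + n2)) / (n1 * n2)"
  using assms by (simp add: Vfun_def delta_def field_simps)

text \<open>First-order condition: \<open>delta\<close> is, up to a nonzero factor, the derivative of the concave
  function \<open>t \<mapsto> Vfun n1 n2 (p1 + t) (p2 + t)\<close> at 0, and an interior point can move in both
  directions.\<close>

lemma Vstar_eq_Vfun_iff:
  assumes n: "n1 > 0" "n2 > 0" and p: "p1 \<in> {0<..<1}" "p2 \<in> {0<..<1}"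
  shows "Vstar n1 n2 (p1 - p2) = Vfun n1 n2 p1 p2 \<longleftrightarrow> delta n1 n2 p1 p2 = 0"
proof
  assume "delta n1 n2 p1 p2 = 0"
  obtain q1 q2 where q: "q1 - q2 = p1 - p2" "Vfun n1 n2 q1 q2 = Vstar n1 n2 (p1 - p2)"
    using Vstar_attained[of "p1 - p2" n1 n2] p by (auto simp: abs_le_iff)
  have "Vfun n1 n2 (p1 + (q1 - p1)) (p2 + (q1 - p1)) \<le> Vfun n1 n2 p1 p2"
    unfolding Vfun_shift[OF n] using \<open>delta n1 n2 p1 p2 = 0\<close> n
    by (simp add: mult.assoc[symmetric])
  also have "p2 + (q1 - p1) = q2" using q by simp
  finally show "Vstar n1 n2 (p1 - p2) = Vfun n1 n2 p1 p2"
    using q Vfun_le_Vstar[of p1 p2 n1 n2] p by auto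
next
  assume max: "Vstar n1 n2 (p1 - p2) = Vfun n1 n2 p1 p2"
  define s where "s = delta n1 n2 p1 p2"
  show "delta n1 n2 p1 p2 = 0"
  proof (rule ccontr)
    assume "delta n1 n2 p1 p2 \<noteq> 0"
    then have s: "s \<noteq> 0" by (simp add: s_def)
    define e where "e = Min {p1, 1 - p1, p2, 1 - p2, \<bar>s\<bar> / (n1 + n2)}"
    have e: "0 < e" "e \<le> p1" "e \<le> 1 - p1" "e \<le> p2" "e \<le> 1 - p2" "e \<le> \<bar>s\<bar> / (n1 + n2)"
      using p n s unfolding e_def by (simp_all, linarith+)
    (* The step goes against the sign of s and is at most half the distance to the second
       point of the segment at which the parabola takes the same value. *)
    define t where "t = - sgn s * e"
    have t: "p1 + t \<in> {0..1}" "p2 + t \<in> {0..1}"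
      using e s by (auto simp: t_def sgn_if)
    have "e * (n1 + n2) \<le> \<bar>s\<bar>"
      using e(6) n by (simp add: pos_le_divide_eq)
    then have "e * (e * (n1 + n2) - 2 * \<bar>s\<bar>) < 0"
      using e(1) s by (intro mult_pos_neg) auto
    also have "e * (e * (n1 + n2) - 2 * \<bar>s\<bar>) = t * (2 * s + t * (n1 + n2))"
      using s by (auto simp: t_def sgn_if algebra_simps)
    finally have "t * (2 * s + t * (n1 + n2)) / (n1 * n2) < 0"
      using n by (simp add: divide_neg_pos)
    then have "Vfun n1 n2 p1 p2 < Vfun n1 n2 (p1 + t) (p2 + t)"
      unfolding Vfun_shift[OF n] s_def by simp
    also have "\<dots> \<le> Vstar n1 n2 (p1 - p2)"
      using Vfun_le_Vstar[OF t, of n1 n2] by simp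
    finally show False using max by simp
  qed
qed

lemma Vfun_reflect: "Vfun n1 n2 (1 - p1) (1 - p2) = Vfun n1 n2 p1 p2"
  by (simp add: Vfun_def mult.commute)

lemma Vfun_swap: "Vfun n2 n1 p2 p1 = Vfun n1 n2 p1 p2"
  by (simp add: Vfun_def)

lemma Vstar_reflect: "Vstar n1 n2 (- p) = Vstar n1 n2 p"
proof -
  have "{Vfun n1 n2 q1 q2 |q1 q2. q1 \<in> {0..1} \<and> q2 \<in> {0..1} \<and> q1 - q2 = - p}
      = {Vfun n1 n2 q1 q2 |q1 q2. q1 \<in> {0..1} \<and> q2 \<in> {0..1} \<and> q1 - q2 = p}" for p
  proof (intro equalityI subsetI; clarify)
    fix q1 q2 :: real
    assume "q1 \<in> {0..1}" "q2 \<in> {0..1}" "q1 - q2 = - p"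
    then show "\<exists>r1 r2. Vfun n1 n2 q1 q2 = Vfun n1 n2 r1 r2 \<and> r1 \<in> {0..1} \<and> r2 \<in> {0..1} \<and> r1 - r2 = p"
      by (intro exI[of _ "1 - q1"] exI[of _ "1 - q2"]) (auto simp: Vfun_reflect)
  next
    fix q1 q2 :: real
    assume "q1 \<in> {0..1}" "q2 \<in> {0..1}" "p = q1 - q2"
    then show "\<exists>r1 r2. Vfun n1 n2 q1 q2 = Vfun n1 n2 r1 r2 \<and> r1 \<in> {0..1} \<and> r2 \<in> {0..1}
        \<and> r1 - r2 = - (q1 - q2)"
      by (intro exI[of _ "1 - q1"] exI[of _ "1 - q2"]) (auto simp: Vfun_reflect)
  qed
  then show ?thesis by (simp add: Vstar_def)
qed

lemma Vstar_swap: "Vstar n2 n1 (- p) = Vstar n1 n2 p"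
proof -
  have "{Vfun n2 n1 q1 q2 |q1 q2. q1 \<in> {0..1} \<and> q2 \<in> {0..1} \<and> q1 - q2 = - p}
      = {Vfun n1 n2 q1 q2 |q1 q2. q1 \<in> {0..1} \<and> q2 \<in> {0..1} \<and> q1 - q2 = p}"
  proof (intro equalityI subsetI; clarify)
    fix q1 q2 :: real
    assume "q1 \<in> {0..1}" "q2 \<in> {0..1}" "q1 - q2 = - p"
    then show "\<exists>r1 r2. Vfun n2 n1 q1 q2 = Vfun n1 n2 r1 r2 \<and> r1 \<in> {0..1} \<and> r2 \<in> {0..1} \<and> r1 - r2 = p"
      by (intro exI[of _ q2] exI[of _ q1]) (auto simp: Vfun_swap)
  next
    fix q1 q2 :: real
    assume "q1 \<in> {0..1}" "q2 \<in> {0..1}" "p = q1 - q2"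
    then show "\<exists>r1 r2. Vfun n1 n2 q1 q2 = Vfun n2 n1 r1 r2 \<and> r1 \<in> {0..1} \<and> r2 \<in> {0..1}
        \<and> r1 - r2 = - (q1 - q2)"
      by (intro exI[of _ q2] exI[of _ q1]) (auto simp: Vfun_swap)
  qed
  then show ?thesis by (simp add: Vstar_def)
qed

lemma Vfun_scale: "Vfun (c1 * N) (c2 * N) q1 q2 = Vfun c1 c2 q1 q2 / N"
  by (simp add: Vfun_def add_divide_distrib)

lemma Vstar_scale:
  assumes N: "N > 0" and p: "\<bar>p\<bar> \<le> 1"
  shows "Vstar (c1 * N) (c2 * N) p = Vstar c1 c2 p / N"
proof (rule antisym)
  obtain q1 q2 where "q1 \<in> {0..1}" "q2 \<in> {0..1}" "q1 - q2 = p"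
      "Vfun (c1 * N) (c2 * N) q1 q2 = Vstar (c1 * N) (c2 * N) p"
    using Vstar_attained[OF p, of "c1 * N" "c2 * N"] by blast
  then show "Vstar (c1 * N) (c2 * N) p \<le> Vstar c1 c2 p / N"
    using divide_right_mono[OF Vfun_le_Vstar[of q1 q2 c1 c2] less_imp_le[OF N]]
    by (simp add: Vfun_scale)
next
  obtain q1 q2 where "q1 \<in> {0..1}" "q2 \<in> {0..1}" "q1 - q2 = p"
      "Vfun c1 c2 q1 q2 = Vstar c1 c2 p"
    using Vstar_attained[OF p, of c1 c2] by blast
  then show "Vstar c1 c2 p / N \<le> Vstar (c1 * N) (c2 * N) p"
    using Vfun_le_Vstar[of q1 q2 "c1 * N" "c2 * N"] by (auto simp: Vfun_scale)
qed

text \<open>The value at the symmetric point \<open>((1 + p) / 2, (1 - p) / 2)\<close>, which is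
  \<open>(1 - p\<^sup>2) / 4 * (1 / n1 + 1 / n2)\<close>, keeps the maximum away from 0 near the diagonal.\<close>

lemma Vstar_lower_bound:
  assumes n: "n1 > 0" "n2 > 0" and p: "\<bar>p\<bar> \<le> 1 / 2"
  shows "(1 / n1 + 1 / n2) / 8 \<le> Vstar n1 n2 p"
proof -
  have "p\<^sup>2 \<le> (1 / 2)\<^sup>2"
    using p abs_le_square_iff[of p "1 / 2"] by simp
  then have "1 / 8 \<le> (1 - p\<^sup>2) / 4" by (simp add: power2_eq_square)
  have "(1 / n1 + 1 / n2) / 8 = (1 / 8) / n1 + (1 / 8) / n2"
    by (simp add: add_divide_distrib)
  also have "\<dots> \<le> ((1 - p\<^sup>2) / 4) / n1 + ((1 - p\<^sup>2) / 4) / n2"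
    using \<open>1 / 8 \<le> (1 - p\<^sup>2) / 4\<close> n by (intro add_mono divide_right_mono) auto
  also have "\<dots> = Vfun n1 n2 ((1 + p) / 2) ((1 - p) / 2)"
    by (simp add: Vfun_def power2_eq_square field_simps)
  also have "\<dots> \<le> Vstar n1 n2 ((1 + p) / 2 - (1 - p) / 2)"
    using p by (intro Vfun_le_Vstar) (auto simp: abs_le_iff)
  also have "(1 + p) / 2 - (1 - p) / 2 = p" by (simp add: field_simps)
  finally show ?thesis .
qed

section \<open>The ratio of standard deviations\<close>

lemma Rratio_ge_one:
  assumes "n1 > 0" "n2 > 0" "p1 \<in> {0<..<1}" "p2 \<in> {0<..<1}"
  shows "Rratio n1 n2 p1 p2 \<ge> 1"
  using Vfun_pos[OF assms] Vfun_le_Vstar[of p1 p2 n1 n2] assms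
  by (simp add: Rratio_def)

lemma Rratio_eq_one_iff:
  assumes "n1 > 0" "n2 > 0" "p1 \<in> {0<..<1}" "p2 \<in> {0<..<1}"
  shows "Rratio n1 n2 p1 p2 = 1 \<longleftrightarrow> delta n1 n2 p1 p2 = 0"
  using Vfun_pos[OF assms] Vstar_eq_Vfun_iff[OF assms]
  by (auto simp: Rratio_def)

lemma Rratio_reflect: "Rratio n1 n2 (1 - p1) (1 - p2) = Rratio n1 n2 p1 p2"
  using Vstar_reflect[of n1 n2 "p1 - p2"] by (simp add: Rratio_def Vfun_reflect)

lemma Rratio_swap: "Rratio n2 n1 p2 p1 = Rratio n1 n2 p1 p2"
  using Vstar_swap[of n2 n1 "p1 - p2"] by (simp add: Rratio_def Vfun_swap)

lemma Rratio_scale: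
  assumes "N > 0" "p1 \<in> {0<..<1}" "p2 \<in> {0<..<1}"
  shows "Rratio (c1 * N) (c2 * N) p1 p2 = Rratio c1 c2 p1 p2"
proof -
  have "\<bar>p1 - p2\<bar> \<le> 1" using assms by (auto simp: abs_le_iff)
  then show ?thesis using assms by (simp add: Rratio_def Vfun_scale Vstar_scale)
qed

text \<open>For equal sample sizes the point \<open>(1/2, 1/2)\<close> lies on the diagonal and has \<open>delta = 0\<close>, so
  it maximises the variance there.\<close>

lemma Rratio_diagonal:
  assumes n: "n > 0" and q: "q \<in> {0<..<1}"
  shows "(Rratio n n q q)\<^sup>2 = inverse (4 * q * (1 - q))"
proof -
  have "Vstar n n 0 = Vfun n n (1 / 2) (1 / 2)"
    using Vstar_eq_Vfun_iff[of n n "1 / 2" "1 / 2"] n by (simp add: delta_def)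
  then have max: "Vstar n n 0 = 1 / (2 * n)"
    by (simp add: Vfun_def)
  have "(Rratio n n q q)\<^sup>2 = Vstar n n 0 / Vfun n n q q"
    using Vfun_pos[OF n n q q] n by (simp add: Rratio_def max)
  also have "\<dots> = inverse (4 * q * (1 - q))"
    using n q unfolding max by (simp add: Vfun_def field_simps)
  finally show ?thesis .
qed

text \<open>In \<open>V\<^sup>* / V\<close> the denominator tends to 0 at the corner while the numerator stays above the
  positive constant of \<open>Vstar_lower_bound\<close>.\<close>

lemma Rratio_at_origin:
  assumes n: "n1 > 0" "n2 > 0"
  shows "filterlim (\<lambda>(p1, p2). Rratio n1 n2 p1 p2) at_top (at (0, 0) within {0<..<1} \<times> {0<..<1})"
proof -
  let ?F = "at (0, 0) within {0<..<1} \<times> {0<..<1} :: (real \<times> real) filter"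
  define k where "k = (1 / n1 + 1 / n2) / 8"
  have k: "k > 0" using n by (simp add: k_def add_pos_pos)
  have dom: "eventually (\<lambda>x. x \<in> {0<..<1} \<times> {0<..<1}) ?F"
    by (simp add: eventually_at_filter)
  have "((\<lambda>x. fst x - snd x) \<longlongrightarrow> 0) ?F"
    by (auto intro!: tendsto_eq_intros)
  then have near: "eventually (\<lambda>x. \<bar>fst x - snd x\<bar> < 1 / 2) ?F"
    using tendstoD[of "\<lambda>x. fst x - snd x" 0 ?F "1 / 2"] by (simp add: dist_real_def)
  have "((\<lambda>x. Vfun n1 n2 (fst x) (snd x)) \<longlongrightarrow> 0) ?F"
    unfolding Vfun_def using n by (auto intro!: tendsto_eq_intros)
  moreover have "eventually (\<lambda>x. 0 < Vfun n1 n2 (fst x) (snd x)) ?F"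
    using dom by eventually_elim (auto intro!: Vfun_pos n)
  ultimately have "filterlim (\<lambda>x. inverse (Vfun n1 n2 (fst x) (snd x))) at_top ?F"
    by (rule filterlim_inverse_at_top)
  from filterlim_tendsto_pos_mult_at_top[OF tendsto_const k this]
  have "filterlim (\<lambda>x. k / Vfun n1 n2 (fst x) (snd x)) at_top ?F"
    by (simp add: divide_inverse)
  then have "filterlim (\<lambda>x. sqrt (k / Vfun n1 n2 (fst x) (snd x))) at_top ?F"
    by (rule filterlim_compose[OF sqrt_at_top])
  then show ?thesis
  proof (rule filterlim_at_top_mono)
    show "\<forall>\<^sub>F x in ?F. sqrt (k / Vfun n1 n2 (fst x) (snd x)) \<le> (case x of (p1, p2) \<Rightarrow> Rratio n1 n2 p1 p2)"
      using dom near
    proof eventually_elim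
      case (elim x)
      then have "0 < Vfun n1 n2 (fst x) (snd x)"
        by (intro Vfun_pos n) auto
      then show ?case
        using Vstar_lower_bound[OF n, of "fst x - snd x"] elim
        unfolding Rratio_def k_def case_prod_beta
        by (intro real_sqrt_le_mono divide_right_mono) auto
    qed
  qed
qed

section \<open>Coverage of the elliptically optimal interval\<close>

text \<open>A square of an affine function minus a concave function is convex, so \<open>Omega\<close> is a sublevel
  set of a convex function.\<close>

lemma convex_Omega:
  assumes n: "n1 > 0" "n2 > 0"
  shows "convex (Omega n1 n2 z x)"
proof (rule convexI)
  fix a b :: "real \<times> real" and u v :: real
  assume ab: "a \<in> Omega n1 n2 z x" "b \<in> Omega n1 n2 z x" and uv: "0 \<le> u" "0 \<le> v" "u + v = 1"
  obtain a1 a2 b1 b2 where eq: "a = (a1, a2)" "b = (b1, b2)"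
    by (cases a, cases b)
  let ?r1 = "u * a1 + v * b1" and ?r2 = "u * a2 + v * b2"
  let ?A = "x - a1 + a2" and ?B = "x - b1 + b2"
  have box: "?r1 \<in> {0..1}" "?r2 \<in> {0..1}"
    using ab uv convexD[of "{0..1::real}" a1 b1 u v] convexD[of "{0..1::real}" a2 b2 u v]
    by (auto simp: Omega_def eq)
  have v: "v = 1 - u" using uv by simp
  have "x - ?r1 + ?r2 = u * ?A + v * ?B"
    unfolding v by (simp add: algebra_simps)
  then have "(x - ?r1 + ?r2)\<^sup>2 = (u * ?A + v * ?B)\<^sup>2" by simp
  also have "\<dots> = u * ?A\<^sup>2 + v * ?B\<^sup>2 - u * v * (?A - ?B)\<^sup>2"
    unfolding v by (simp add: algebra_simps power2_eq_square)
  also have "\<dots> \<le> u * ?A\<^sup>2 + v * ?B\<^sup>2"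
    using uv by simp
  also have "\<dots> \<le> u * (z\<^sup>2 * Vfun n1 n2 a1 a2) + v * (z\<^sup>2 * Vfun n1 n2 b1 b2)"
    using ab uv by (intro add_mono mult_left_mono) (auto simp: Omega_def eq)
  also have "\<dots> = z\<^sup>2 * (u * Vfun n1 n2 a1 a2 + v * Vfun n1 n2 b1 b2)"
    by (simp add: algebra_simps)
  also have "\<dots> \<le> z\<^sup>2 * Vfun n1 n2 ?r1 ?r2"
  proof (rule mult_left_mono)
    have "Vfun n1 n2 ?r1 ?r2 = u * Vfun n1 n2 a1 a2 + v * Vfun n1 n2 b1 b2
        + u * v * ((a1 - b1)\<^sup>2 / n1 + (a2 - b2)\<^sup>2 / n2)"
      unfolding v using n by (simp add: Vfun_def field_simps power2_eq_square)
    then show "u * Vfun n1 n2 a1 a2 + v * Vfun n1 n2 b1 b2 \<le> Vfun n1 n2 ?r1 ?r2"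
      using uv n by (simp add: add_nonneg_nonneg)
  qed simp
  finally show "u *\<^sub>R a + v *\<^sub>R b \<in> Omega n1 n2 z x"
    using box by (simp add: Omega_def eq)
qed

lemma Gamma_set_iff:
  assumes n: "n1 > 0" "n2 > 0" and p: "p1 \<in> {0..1}" "p2 \<in> {0..1}"
  shows "(p1, p2) \<in> Gamma_set n1 n2 z x \<longleftrightarrow> (x - (p1 - p2))\<^sup>2 \<le> z\<^sup>2 * Vstar n1 n2 (p1 - p2)"
proof
  assume G: "(p1, p2) \<in> Gamma_set n1 n2 z x"
  then have ne: "Omega n1 n2 z x \<noteq> {}" by (auto simp: Gamma_set_def)
  let ?D = "(\<lambda>r. fst r - snd r) ` Omega n1 n2 z x"
  have "linear (\<lambda>r :: real \<times> real. fst r - snd r)"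
    by (intro linearI) (auto simp: algebra_simps)
  then have "is_interval ?D"
    unfolding is_interval_convex_1 by (rule convex_linear_image[OF _ convex_Omega[OF n]])
  moreover have "eo_lower n1 n2 z x \<in> ?D" "eo_upper n1 n2 z x \<in> ?D"
    using eo_bounds_attained(1,2)[OF ne] by (force simp: image_iff)+
  ultimately have "p1 - p2 \<in> ?D"
    using G ne by (auto simp: Gamma_set_def intro: mem_is_interval_1_I)
  then obtain r1 r2 where r: "(r1, r2) \<in> Omega n1 n2 z x" "p1 - p2 = r1 - r2"
    by auto
  then have "(x - (r1 - r2))\<^sup>2 \<le> z\<^sup>2 * Vfun n1 n2 r1 r2"
    by (simp add: Omega_def algebra_simps)
  also have "\<dots> \<le> z\<^sup>2 * Vstar n1 n2 (r1 - r2)"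
    using r by (intro mult_left_mono Vfun_le_Vstar) (auto simp: Omega_def)
  finally show "(x - (p1 - p2))\<^sup>2 \<le> z\<^sup>2 * Vstar n1 n2 (p1 - p2)"
    using r by simp
next
  assume le: "(x - (p1 - p2))\<^sup>2 \<le> z\<^sup>2 * Vstar n1 n2 (p1 - p2)"
  obtain q1 q2 where q: "q1 \<in> {0..1}" "q2 \<in> {0..1}" "q1 - q2 = p1 - p2"
      "Vfun n1 n2 q1 q2 = Vstar n1 n2 (p1 - p2)"
    using Vstar_attained[of "p1 - p2" n1 n2] p by (auto simp: abs_le_iff)
  have [simp]: "x - q1 + q2 = x - (p1 - p2)" using q(3) by simp
  then have Om: "(q1, q2) \<in> Omega n1 n2 z x"
    using q(1,2,4) le by (simp add: Omega_def)
  then have ne: "Omega n1 n2 z x \<noteq> {}" by blast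
  from bspec[OF eo_bounds_attained(3)[OF ne] Om]
  show "(p1, p2) \<in> Gamma_set n1 n2 z x"
    using q(3) p ne by (simp add: Gamma_set_def)
qed

lemma Error_eq_Phi:
  assumes n: "n1 > 0" "n2 > 0" and z: "z > 0" and p: "p1 \<in> {0<..<1}" "p2 \<in> {0<..<1}"
  shows "Error n1 n2 z p1 p2 = 2 * (Phi (z * Rratio n1 n2 p1 p2) - Phi z)"
proof -
  let ?V = "Vfun n1 n2 p1 p2" and ?W = "Vstar n1 n2 (p1 - p2)"
  have V: "?V > 0" by (rule Vfun_pos[OF n p])
  have W: "?W \<ge> 0" using V Vfun_le_Vstar[of p1 p2 n1 n2] p by auto
  have G: "{x. (p1, p2) \<in> Gamma_set n1 n2 z x} = {x. (x - (p1 - p2))\<^sup>2 \<le> z\<^sup>2 * ?W}"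
    using Gamma_set_iff[OF n, of p1 p2] p by auto
  have O: "{x. (p1, p2) \<in> Omega n1 n2 z x} = {x. (x - (p1 - p2))\<^sup>2 \<le> z\<^sup>2 * ?V}"
    using p by (auto simp: Omega_def algebra_simps)
  show ?thesis
    unfolding Error_def G O
    using V by (simp add: normal_law_central[OF V W z] normal_law_central[OF V less_imp_le[OF V] z] Rratio_def)
qed

lemma Error_eq_0_iff:
  assumes n: "n1 > 0" "n2 > 0" and z: "z > 0" and p: "p1 \<in> {0<..<1}" "p2 \<in> {0<..<1}"
  shows "Error n1 n2 z p1 p2 = 0 \<longleftrightarrow> delta n1 n2 p1 p2 = 0"
proof -
  have "Error n1 n2 z p1 p2 = 0 \<longleftrightarrow> Phi (z * Rratio n1 n2 p1 p2) = Phi z"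
    by (simp add: Error_eq_Phi[OF assms])
  also have "\<dots> \<longleftrightarrow> z * Rratio n1 n2 p1 p2 = z"
    by (rule strict_mono_eq[OF Phi_strict_mono])
  also have "\<dots> \<longleftrightarrow> delta n1 n2 p1 p2 = 0"
    using z Rratio_eq_one_iff[OF n p] by simp
  finally show ?thesis .
qed

lemma Error_nonneg:
  assumes n: "n1 > 0" "n2 > 0" and z: "z > 0" and p: "p1 \<in> {0<..<1}" "p2 \<in> {0<..<1}"
  shows "0 \<le> Error n1 n2 z p1 p2"
  using strict_mono_less_eq[OF Phi_strict_mono, of z "z * Rratio n1 n2 p1 p2"]
    Rratio_ge_one[OF n p] z
  by (simp add: Error_eq_Phi[OF assms])

lemma Error_less:
  assumes n: "n1 > 0" "n2 > 0" and z: "z > 0" and p: "p1 \<in> {0<..<1}" "p2 \<in> {0<..<1}"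
  shows "Error n1 n2 z p1 p2 < 2 * (1 - Phi z)"
  using Phi_less_one by (simp add: Error_eq_Phi[OF assms])

lemma Error_reflect:
  assumes "n1 > 0" "n2 > 0" "z > 0" "p1 \<in> {0<..<1}" "p2 \<in> {0<..<1}"
  shows "Error n1 n2 z (1 - p1) (1 - p2) = Error n1 n2 z p1 p2"
  using assms by (simp add: Error_eq_Phi Rratio_reflect)

lemma Error_swap:
  assumes "n1 > 0" "n2 > 0" "z > 0" "p1 \<in> {0<..<1}" "p2 \<in> {0<..<1}"
  shows "Error n2 n1 z p2 p1 = Error n1 n2 z p1 p2"
  using assms by (simp add: Error_eq_Phi Rratio_swap)

lemma Error_at_origin:
  assumes n: "n1 > 0" "n2 > 0" and z: "z > 0"
  shows "((\<lambda>(p1, p2). Error n1 n2 z p1 p2) \<longlongrightarrow> 2 * (1 - Phi z))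
    (at (0, 0) within {0<..<1} \<times> {0<..<1})"
proof -
  let ?F = "at (0, 0) within {0<..<1} \<times> {0<..<1} :: (real \<times> real) filter"
  let ?R = "\<lambda>(p1, p2). Rratio n1 n2 p1 p2"
  have "filterlim (\<lambda>x. z * ?R x) at_top ?F"
    using z by (intro filterlim_tendsto_pos_mult_at_top[OF tendsto_const _ Rratio_at_origin[OF n]])
  then have "((\<lambda>x. Phi (z * ?R x)) \<longlongrightarrow> 1) ?F"
    by (rule filterlim_compose[OF Phi_tendsto_one])
  then have "((\<lambda>x. 2 * (Phi (z * ?R x) - Phi z)) \<longlongrightarrow> 2 * (1 - Phi z)) ?F"
    by (intro tendsto_intros)
  moreover have "eventually (\<lambda>x. 2 * (Phi (z * ?R x) - Phi z) = (case x of (p1, p2) \<Rightarrow> Error n1 n2 z p1 p2)) ?F"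
    unfolding eventually_at_filter using n z by (intro always_eventually) (auto simp: Error_eq_Phi)
  ultimately show ?thesis
    by (rule Lim_transform_eventually)
qed

text \<open>The reflection \<open>x \<mapsto> (1, 1) - x\<close> of the square carries this corner to the origin.\<close>

lemma Error_at_one:
  assumes n: "n1 > 0" "n2 > 0" and z: "z > 0"
  shows "((\<lambda>(p1, p2). Error n1 n2 z p1 p2) \<longlongrightarrow> 2 * (1 - Phi z))
    (at (1, 1) within {0<..<1} \<times> {0<..<1})"
proof -
  let ?S = "{0<..<1} \<times> {0<..<1} :: (real \<times> real) set"
  have "filterlim (\<lambda>x. (1, 1) - x) (at (0, 0) within ?S) (at (1, 1) within ?S)"
    unfolding filterlim_at
    by (auto simp: eventually_at_filter zero_prod_def[symmetric] intro!: tendsto_eq_intros always_eventually)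
  from filterlim_compose[OF Error_at_origin[OF n z] this]
  have "((\<lambda>x. case (1, 1) - x of (p1, p2) \<Rightarrow> Error n1 n2 z p1 p2) \<longlongrightarrow> 2 * (1 - Phi z))
      (at (1, 1) within ?S)" .
  moreover have "eventually (\<lambda>x. (case (1, 1) - x of (p1, p2) \<Rightarrow> Error n1 n2 z p1 p2)
      = (case x of (p1, p2) \<Rightarrow> Error n1 n2 z p1 p2)) (at (1, 1) within ?S)"
    unfolding eventually_at_filter using n z
    by (intro always_eventually) (auto simp: Error_reflect)
  ultimately show ?thesis
    by (rule Lim_transform_eventually)
qed

section \<open>The line of zero error\<close>

lemma delta_eq_0_iff_beta:
  assumes "n1 > 0" "n2 > 0"
  shows "delta n1 n2 p1 p2 = 0 \<longleftrightarrow> beta1 n1 n2 * p1 + beta2 n1 n2 * p2 = 1"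
proof -
  have "beta1 n1 n2 * p1 + beta2 n1 n2 * p2 - 1 = 2 * delta n1 n2 p1 p2 / (n1 + n2)"
    using assms by (simp add: delta_def beta1_def beta2_def divide_simps) (simp add: algebra_simps)
  then show ?thesis
    using assms by (simp add: eq_iff_diff_eq_0[of _ 1])
qed

lemma delta_eq_0_iff_slope:
  assumes "n1 > 0" "n2 > 0"
  shows "delta n1 n2 p1 p2 = 0 \<longleftrightarrow> p2 - 1/2 = - (n2 / n1) * (p1 - 1/2)"
proof -
  have "delta n1 n2 p1 p2 = n1 * (p2 - 1/2 + (n2 / n1) * (p1 - 1/2))"
    using assms by (simp add: delta_def distrib_left)
  then show ?thesis
    using assms by (simp add: eq_neg_iff_add_eq_0)
qed

text \<open>The line leaves the square through the pair of sides that fixes the coordinate with the larger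
  sample size at 0 or 1. There that coordinate is at distance \<open>1 / 2\<close> from the centre and the other
  one, on the opposite side, at distance \<open>min n1 n2 / (2 * max n1 n2)\<close>.\<close>

lemma delta_eq_0_imp_diff_less:
  assumes n: "n1 > 0" "n2 > 0" and p: "p1 \<in> {0<..<1}" "p2 \<in> {0<..<1}"
    and d: "delta n1 n2 p1 p2 = 0"
  shows "\<bar>p1 - p2\<bar> < phat_sq n1 n2"
proof -
  have half: "\<bar>p1 - 1/2\<bar> < 1/2" "\<bar>p2 - 1/2\<bar> < 1/2"
    using p unfolding greaterThanLessThan_iff by linarith+
  have e: "n2 * (p1 - 1/2) = - (n1 * (p2 - 1/2))"
    using d by (simp only: delta_def eq_neg_iff_add_eq_0)
  show ?thesis
  proof (cases "n1 \<le> n2")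
    case True
    have "n2 * (p1 - p2) = - ((n1 + n2) * (p2 - 1/2))"
      using e unfolding ring_distribs by linarith
    then have "n2 * \<bar>p1 - p2\<bar> = (n1 + n2) * \<bar>p2 - 1/2\<bar>"
      using n by (metis abs_minus_cancel abs_mult abs_of_pos add_pos_pos)
    also have "\<dots> < (n1 + n2) * (1/2)"
      using n half by (intro mult_strict_left_mono) auto
    finally show ?thesis using True n by (simp add: phat_sq_def field_simps max_def min_def)
  next
    case False
    have "n1 * (p1 - p2) = (n1 + n2) * (p1 - 1/2)"
      using e unfolding ring_distribs by linarith
    then have "n1 * \<bar>p1 - p2\<bar> = (n1 + n2) * \<bar>p1 - 1/2\<bar>"
      using n by (metis abs_mult abs_of_pos add_pos_pos)
    also have "\<dots> < (n1 + n2) * (1/2)"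
      using n half by (intro mult_strict_left_mono) auto
    finally show ?thesis using False n by (simp add: phat_sq_def field_simps max_def min_def)
  qed
qed

lemma Error_pos_beyond:
  assumes n: "n1 > 0" "n2 > 0" and z: "z > 0" and p: "p1 \<in> {0<..<1}" "p2 \<in> {0<..<1}"
    and "\<bar>p1 - p2\<bar> > phat_sq n1 n2"
  shows "Error n1 n2 z p1 p2 > 0"
  using Error_nonneg[OF n z p] Error_eq_0_iff[OF n z p] delta_eq_0_imp_diff_less[OF n p] assms(6)
  by fastforce

section \<open>The error for proportional sample sizes\<close>

text \<open>The ratio is scale invariant, so the error is constant in \<open>N > 0\<close> and equals its own limit.\<close>

lemma Error_scale_limit:
  assumes c: "c1 > 0" "c2 > 0" and z: "z > 0" and p: "p1 \<in> {0<..<1}" "p2 \<in> {0<..<1}"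
    and M: "M > 0" and off: "delta (c1 * M) (c2 * M) p1 p2 \<noteq> 0"
  defines "L \<equiv> 2 * (Phi (z * Rratio (c1 * M) (c2 * M) p1 p2) - Phi z)"
  shows "0 < L" and "((\<lambda>N. Error (c1 * N) (c2 * N) z p1 p2) \<longlongrightarrow> L) at_top"
    and "\<not> ((\<lambda>N. Error (c1 * N) (c2 * N) z p1 p2) \<longlongrightarrow> 0) at_top"
proof -
  have cM: "c1 * M > 0" "c2 * M > 0" using c M by simp_all
  have L: "L = Error (c1 * M) (c2 * M) z p1 p2"
    unfolding L_def by (rule Error_eq_Phi[OF cM z p, symmetric])
  show pos: "0 < L"
    unfolding L using Error_nonneg[OF cM z p] Error_eq_0_iff[OF cM z p] off by linarith
  have "eventually (\<lambda>N. L = Error (c1 * N) (c2 * N) z p1 p2) at_top"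
    using eventually_gt_at_top[of 0]
  proof eventually_elim
    case (elim N)
    then show ?case
      unfolding L_def using c z p M by (simp add: Error_eq_Phi Rratio_scale)
  qed
  then show lim: "((\<lambda>N. Error (c1 * N) (c2 * N) z p1 p2) \<longlongrightarrow> L) at_top"
    by (rule Lim_transform_eventually[OF tendsto_const])
  show "\<not> ((\<lambda>N. Error (c1 * N) (c2 * N) z p1 p2) \<longlongrightarrow> 0) at_top"
    using tendsto_unique[OF _ lim] pos by (metis less_irrefl trivial_limit_at_top_linorder)
qed


theorem corollary5:
  fixes n1 n2 \<alpha> z :: real
  assumes n1: "n1 > 0" and n2: "n2 > 0"
    and alpha: "0 < \<alpha>" "\<alpha> < 1"
    and z_quantile: "Phi z = 1 - \<alpha> / 2" and z_pos: "z > 0"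
  shows
    "((\<forall>p1\<in>{0<..<1}. \<forall>p2\<in>{0<..<1}. 0 \<le> Error n1 n2 z p1 p2 \<and> Error n1 n2 z p1 p2 < \<alpha>)
     \<and> ((\<lambda>(p1, p2). Error n1 n2 z p1 p2) \<longlongrightarrow> \<alpha>) (at (0, 0) within {0<..<1} \<times> {0<..<1})
     \<and> ((\<lambda>(p1, p2). Error n1 n2 z p1 p2) \<longlongrightarrow> \<alpha>) (at (1, 1) within {0<..<1} \<times> {0<..<1}))
     \<and>
     ((\<forall>p1\<in>{0<..<1}. \<forall>p2\<in>{0<..<1}. \<bar>p1 - p2\<bar> \<le> phat_sq n1 n2 \<longrightarrow>
        (Error n1 n2 z p1 p2 = 0 \<longleftrightarrow> delta n1 n2 p1 p2 = 0))
     \<and> (\<forall>p1 p2. delta n1 n2 p1 p2 = 0 \<longleftrightarrow> beta1 n1 n2 * p1 + beta2 n1 n2 * p2 = 1)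
     \<and> {(p1, p2). beta1 n1 n2 * p1 + beta2 n1 n2 * p2 = 1}
         = {(p1, p2). p2 - 1/2 = - (n2 / n1) * (p1 - 1/2)}
     \<and> beta1 n1 n2 + beta2 n1 n2 = 2
     \<and> (n1 = n2 \<longrightarrow>
          {(p1, p2). beta1 n1 n2 * p1 + beta2 n1 n2 * p2 = 1} = {(p1, p2). p1 + p2 = 1})
     \<and> (\<forall>p1\<in>{0..1}. \<forall>p2\<in>{0..1}. \<bar>p1 - p2\<bar> > phat_sq n1 n2 \<and> Error n1 n2 z p1 p2 = 0
          \<longrightarrow> (p1, p2) \<in> frontier ({0..1} \<times> {0..1}))
     \<and> (\<forall>p1\<in>{0<..<1}. \<forall>p2\<in>{0<..<1}. \<bar>p1 - p2\<bar> > phat_sq n1 n2 \<longrightarrow> Error n1 n2 z p1 p2 > 0))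
     \<and>
     (\<forall>p1\<in>{0<..<1}. \<forall>p2\<in>{0<..<1}.
        Error n1 n2 z (1 - p1) (1 - p2) = Error n1 n2 z p1 p2
        \<and> Error n2 n1 z p2 p1 = Error n1 n2 z p1 p2)
     \<and>
     ((\<forall>c1>0. \<forall>c2>0. \<forall>p1\<in>{0<..<1}. \<forall>p2\<in>{0<..<1}.
        (\<forall>N>0. \<forall>M>0. Rratio (c1 * N) (c2 * N) p1 p2 = Rratio (c1 * M) (c2 * M) p1 p2)
        \<and> (\<forall>M>0. beta1 (c1 * M) (c2 * M) * p1 + beta2 (c1 * M) (c2 * M) * p2 \<noteq> 1 \<longrightarrow>
              0 < 2 * (Phi (z * Rratio (c1 * M) (c2 * M) p1 p2) - Phi z)
              \<and> ((\<lambda>N. Error (c1 * N) (c2 * N) z p1 p2)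
                   \<longlongrightarrow> 2 * (Phi (z * Rratio (c1 * M) (c2 * M) p1 p2) - Phi z)) at_top
              \<and> \<not> ((\<lambda>N. Error (c1 * N) (c2 * N) z p1 p2) \<longlongrightarrow> 0) at_top))
     \<and> (\<forall>n>0. \<forall>q\<in>{0<..<1}. (Rratio n n q q)\<^sup>2 = inverse (4 * q * (1 - q))))"
proof (intro conjI)
  have \<alpha>: "\<alpha> = 2 * (1 - Phi z)" using z_quantile by simp
  show "\<forall>p1\<in>{0<..<1}. \<forall>p2\<in>{0<..<1}. 0 \<le> Error n1 n2 z p1 p2 \<and> Error n1 n2 z p1 p2 < \<alpha>"
    unfolding \<alpha> using Error_nonneg[OF n1 n2 z_pos] Error_less[OF n1 n2 z_pos] by blast
  show "((\<lambda>(p1, p2). Error n1 n2 z p1 p2) \<longlongrightarrow> \<alpha>) (at (0, 0) within {0<..<1} \<times> {0<..<1})"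
    unfolding \<alpha> by (rule Error_at_origin[OF n1 n2 z_pos])
  show "((\<lambda>(p1, p2). Error n1 n2 z p1 p2) \<longlongrightarrow> \<alpha>) (at (1, 1) within {0<..<1} \<times> {0<..<1})"
    unfolding \<alpha> by (rule Error_at_one[OF n1 n2 z_pos])
next
  show "\<forall>p1\<in>{0<..<1}. \<forall>p2\<in>{0<..<1}. \<bar>p1 - p2\<bar> \<le> phat_sq n1 n2 \<longrightarrow>
      (Error n1 n2 z p1 p2 = 0 \<longleftrightarrow> delta n1 n2 p1 p2 = 0)"
    using Error_eq_0_iff[OF n1 n2 z_pos] by blast
  show "\<forall>p1 p2. delta n1 n2 p1 p2 = 0 \<longleftrightarrow> beta1 n1 n2 * p1 + beta2 n1 n2 * p2 = 1"
    using delta_eq_0_iff_beta[OF n1 n2] by blast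
  show "{(p1, p2). beta1 n1 n2 * p1 + beta2 n1 n2 * p2 = 1}
      = {(p1, p2). p2 - 1/2 = - (n2 / n1) * (p1 - 1/2)}"
    using delta_eq_0_iff_beta[OF n1 n2] delta_eq_0_iff_slope[OF n1 n2] by blast
  show "beta1 n1 n2 + beta2 n1 n2 = 2"
    using n1 n2 by (simp add: beta1_def beta2_def add_divide_distrib[symmetric] divide_eq_eq)
  show "n1 = n2 \<longrightarrow>
      {(p1, p2). beta1 n1 n2 * p1 + beta2 n1 n2 * p2 = 1} = {(p1, p2). p1 + p2 = 1}"
    using n1 by (auto simp: beta1_def beta2_def)
  show pos: "\<forall>p1\<in>{0<..<1}. \<forall>p2\<in>{0<..<1}. \<bar>p1 - p2\<bar> > phat_sq n1 n2 \<longrightarrow> Error n1 n2 z p1 p2 > 0"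
    using Error_pos_beyond[OF n1 n2 z_pos] by blast
  have "frontier ({0..1} \<times> {0..1}) = {0..1} \<times> {0..1} - {0<..<1::real} \<times> {0<..<1::real}"
    by (simp add: frontier_def interior_Times closure_Times)
  with pos show "\<forall>p1\<in>{0..1}. \<forall>p2\<in>{0..1}. \<bar>p1 - p2\<bar> > phat_sq n1 n2 \<and> Error n1 n2 z p1 p2 = 0
      \<longrightarrow> (p1, p2) \<in> frontier ({0..1} \<times> {0..1})"
    by force
next
  show "\<forall>p1\<in>{0<..<1}. \<forall>p2\<in>{0<..<1}.
      Error n1 n2 z (1 - p1) (1 - p2) = Error n1 n2 z p1 p2
      \<and> Error n2 n1 z p2 p1 = Error n1 n2 z p1 p2"
    using Error_reflect[OF n1 n2 z_pos] Error_swap[OF n1 n2 z_pos] by blast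
next
  show "\<forall>c1>0. \<forall>c2>0. \<forall>p1\<in>{0<..<1}. \<forall>p2\<in>{0<..<1}.
      (\<forall>N>0. \<forall>M>0. Rratio (c1 * N) (c2 * N) p1 p2 = Rratio (c1 * M) (c2 * M) p1 p2)
      \<and> (\<forall>M>0. beta1 (c1 * M) (c2 * M) * p1 + beta2 (c1 * M) (c2 * M) * p2 \<noteq> 1 \<longrightarrow>
            0 < 2 * (Phi (z * Rratio (c1 * M) (c2 * M) p1 p2) - Phi z)
            \<and> ((\<lambda>N. Error (c1 * N) (c2 * N) z p1 p2)
                 \<longlongrightarrow> 2 * (Phi (z * Rratio (c1 * M) (c2 * M) p1 p2) - Phi z)) at_top
            \<and> \<not> ((\<lambda>N. Error (c1 * N) (c2 * N) z p1 p2) \<longlongrightarrow> 0) at_top)"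
    (is "\<forall>c1>0. \<forall>c2>0. \<forall>p1\<in>_. \<forall>p2\<in>_. ?scale c1 c2 p1 p2 \<and> (\<forall>M>0. _ \<longrightarrow> ?limit c1 c2 p1 p2 M)")
  proof (intro allI impI ballI, rule conjI)
    fix c1 c2 p1 p2 :: real
    assume c: "0 < c1" "0 < c2" and p: "p1 \<in> {0<..<1}" "p2 \<in> {0<..<1}"
    show "?scale c1 c2 p1 p2"
      using p by (simp add: Rratio_scale)
    show "\<forall>M>0. beta1 (c1 * M) (c2 * M) * p1 + beta2 (c1 * M) (c2 * M) * p2 \<noteq> 1 \<longrightarrow>
        ?limit c1 c2 p1 p2 M"
    proof (intro allI impI)
      fix M :: real
      assume M: "0 < M" and "beta1 (c1 * M) (c2 * M) * p1 + beta2 (c1 * M) (c2 * M) * p2 \<noteq> 1"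
      then have "delta (c1 * M) (c2 * M) p1 p2 \<noteq> 0"
        using c by (simp add: delta_eq_0_iff_beta)
      from Error_scale_limit[OF c z_pos p M this] show "?limit c1 c2 p1 p2 M"
        by blast
    qed
  qed
  show "\<forall>n>0. \<forall>q\<in>{0<..<1}. (Rratio n n q q)\<^sup>2 = inverse (4 * q * (1 - q))"
    using Rratio_diagonal by blast
qed

end
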